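(* Let $\mathcal G=([m],E)$ be a directed tree. Then $(\mathcal G,c^* )$, with $c^*$ the constant coloring, is a $\pi$-graph if and only if $w_{\mathcal G}(h)\ge w_{\mathcal G}(h')$ whenever $0\le h\le h'\le h(\mathcal G)$.
   Context: A directed tree $\mathcal G=([m],E)$ is a directed acyclic graph on $[m]=\{1,\dots,m\}$ whose underlying undirected graph is a tree and which has a unique source node (root) $r$. The height of a vertex $v$ is the length of the unique directed path from $r$ to $v$; $h(\mathcal G)$ is the length of the longest directed path in $\mathcal G$. A trek between $i$ and $j$ is a pair $T=\{P,Q\}$ of directed paths (length zero allowed) with a common starting node $\mathrm{top}(T)$, $P$ ending at $i$ and $Q$ ending at $j$; its length is $|P|+|Q|$ (number of edges). It is simple if $\mathrm{top}(T)$ is the only node common to $P$ and $Q$. For $0\le h\le h(\mathcal G)$, $w_{\mathcal G}(h)$ is the maximum length of a simple trek whose top node has height $h$. Let $N$ be the length of the longest trek in $\mathcal G$. For $i,j\in[m]$ let $t(i,j)\in\mathbb Z_{\ge0}^{\{0,1,\dots,N\}}$ be the vector whose $k$-th entry is the number of treks between $i$ and $j$ of length $k$ (the coefficient vector of the trek polynomial under the constant coloring $c^*$, in which all vertices share one parameter $\omega$ and all edges share one parameter $\lambda$). Let $P_{\mathcal G}$ be the set of all coordinatewise minima $\bigwedge_{(i,j)\in S}t(i,j)$ over nonempty $S\subseteq\{(i,j):1\le i\le j\le m\}$ (partially ordered coordinatewise). $(\mathcal G,c^* )$ is called a $\pi$-graph if $P_{\mathcal G}$ is a $\pi$-system, i.e.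 $P_{\mathcal G}\subseteq\{0\}\cup\{t(i,j):1\le i\le j\le m\}$. *)

theory Defs
  imports "Graph_Theory.Graph_Theory" "HOL-Library.FuncSet"
begin

abbreviation dpath :: "nat pair_pre_digraph \<Rightarrow> nat \<Rightarrow> (nat \<times> nat) awalk \<Rightarrow> nat \<Rightarrow> bool" where
  "dpath G \<equiv> pre_digraph.apath (with_proj G)"

(* The constant tree of Graph_Theory is not usable here: its notion of cycle counts
   u - v - u as a cycle of the symmetric closure. For a digraph without loops, a cycle of
   the underlying simple undirected graph is a cycle of length at least 3 of the
   symmetric closure. *)
definition underlying_tree :: "nat pair_pre_digraph \<Rightarrow> bool" where
  "underlying_tree G \<longleftrightarrow>
     connected (with_proj G) \<and>
     (\<nexists>p. pre_digraph.cycle (with_proj (mk_symmetric (with_proj G))) p \<and> 3 \<le> length p)"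

definition source :: "nat pair_pre_digraph \<Rightarrow> nat \<Rightarrow> bool" where
  "source G v \<longleftrightarrow> v \<in> pverts G \<and> in_arcs (with_proj G) v = {}"

locale directed_tree = pair_wf_digraph G
  for m :: nat and G :: "nat pair_pre_digraph" +
  assumes verts_eq: "pverts G = {1..m}"
    and dag: "acyclic (parcs G)"
    and underlying: "underlying_tree G"
    and unique_source: "\<exists>!r. source G r"

definition tree_root :: "nat pair_pre_digraph \<Rightarrow> nat" where
  "tree_root G = (THE r. source G r)"

definition height :: "nat pair_pre_digraph \<Rightarrow> nat \<Rightarrow> nat" where
  "height G v = length (THE p. dpath G (tree_root G) p v)"

definition graph_height :: "nat pair_pre_digraph \<Rightarrow> nat" where
  "graph_height G = Max {length p |u p v. dpath G u p v}"

(* A trek is stored with its top node, since a path of length zero is the empty list of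
   arcs. The paths form an ordered pair; for i = j this gives the same count as unordered
   pairs in a directed tree, where two directed paths with the same ends are equal. *)
type_synonym trek = "nat \<times> (nat \<times> nat) awalk \<times> (nat \<times> nat) awalk"

definition treks :: "nat pair_pre_digraph \<Rightarrow> nat \<Rightarrow> nat \<Rightarrow> trek set" where
  "treks G i j = {(s, P, Q). dpath G s P i \<and> dpath G s Q j}"

fun trek_top :: "trek \<Rightarrow> nat" where
  "trek_top (s, P, Q) = s"

fun trek_length :: "trek \<Rightarrow> nat" where
  "trek_length (s, P, Q) = length P + length Q"

fun simple_trek :: "trek \<Rightarrow> bool" where
  "simple_trek (s, P, Q) \<longleftrightarrow> set (pawalk_verts s P) \<inter> set (pawalk_verts s Q) = {s}"

definition width :: "nat pair_pre_digraph \<Rightarrow> nat \<Rightarrow> nat" where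
  "width G h = Max {trek_length T |T i j.
     T \<in> treks G i j \<and> simple_trek T \<and> height G (trek_top T) = h}"

definition longest_trek :: "nat pair_pre_digraph \<Rightarrow> nat" where
  "longest_trek G = Max {trek_length T |T i j. T \<in> treks G i j}"

(* Vectors indexed by {0..N}, N = longest_trek G, are functions restricted to {0..N}
   (and hence undefined outside), so that equality is equality of the N + 1 entries. *)
definition trek_vector :: "nat pair_pre_digraph \<Rightarrow> nat \<Rightarrow> nat \<Rightarrow> nat \<Rightarrow> nat" where
  "trek_vector G i j =
     (\<lambda>k\<in>{0..longest_trek G}. card {T \<in> treks G i j. trek_length T = k})"

definition vertex_pairs :: "nat pair_pre_digraph \<Rightarrow> (nat \<times> nat) set" where
  "vertex_pairs G = {(i, j). i \<in> pverts G \<and> j \<in> pverts G \<and> i \<le> j}"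

definition trek_meets :: "nat pair_pre_digraph \<Rightarrow> (nat \<Rightarrow> nat) set" where
  "trek_meets G =
     {\<lambda>k\<in>{0..longest_trek G}. Min ((\<lambda>(i, j). trek_vector G i j k) ` S) |S.
        S \<noteq> {} \<and> S \<subseteq> vertex_pairs G}"

(* The pi-graph condition for the constant coloring: all vertices share one parameter and
   all edges share one parameter, so a trek contributes only through its length. *)
definition pi_graph_const :: "nat pair_pre_digraph \<Rightarrow> bool" where
  "pi_graph_const G \<longleftrightarrow>
     trek_meets G \<subseteq>
       {\<lambda>k\<in>{0..longest_trek G}. 0} \<union> {trek_vector G i j |i j. (i, j) \<in> vertex_pairs G}"

end

theory Submission
  imports Defs
begin

text \<open>
  All treks between two vertices arise from a single simple one by moving its top node \<open>s\<close> up
  towards the root. If the simple trek has length \<open>l\<close> and its top has height \<open>a\<close>, the trek vector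
  is therefore the indicator of \<open>{l, l + 2, \<dots>, l + 2 a}\<close>. Truncating simple treks shows that
  the pairs \<open>(l, a)\<close> that occur are exactly those with \<open>l \<le> width a\<close> and \<open>a\<close> at most the height of
  the tree. The minimum of two such indicators is zero or the one of a pair with the larger start
  \<open>l'\<close> and a height \<open>b \<le> a'\<close>, and this pair occurs if the width is antimonotone. Conversely, if
  \<open>w = width (h + 1) > width h\<close>, the vectors of \<open>(w - 2, h + 1)\<close> and \<open>(w, h + 1)\<close> meet in the
  indicator for \<open>(w, h)\<close>, which is not a trek vector.
\<close>

section \<open>Shapes of simple treks and their indicator vectors\<close>

definition trek_shapes :: "nat pair_pre_digraph \<Rightarrow> (nat \<times> nat) set" where
  "trek_shapes G =
    {(trek_length T, height G (trek_top T)) |T i j. T \<in> treks G i j \<and> simple_trek T}"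

text \<open>Testing the parity of \<open>k + l\<close> keeps truncated subtraction out of the
  formula.\<close>

definition progression_vector :: "nat pair_pre_digraph \<Rightarrow> nat \<Rightarrow> nat \<Rightarrow> nat \<Rightarrow> nat" where
  "progression_vector G l a =
    (\<lambda>k\<in>{0..longest_trek G}. of_bool (l \<le> k \<and> k \<le> l + 2 * a \<and> even (k + l)))"

lemma progression_vector_apply:
  "k \<in> {0..longest_trek G} \<Longrightarrow>
    progression_vector G l a k = of_bool (l \<le> k \<and> k \<le> l + 2 * a \<and> even (k + l))"
  by (simp add: progression_vector_def)

lemma min_of_bool: "min (of_bool A) (of_bool B :: nat) = of_bool (A \<and> B)"
  by (cases A; cases B) simp_all

lemma trek_shapesI:
  assumes "(s, P, Q) \<in> treks G i j" "simple_trek (s, P, Q)"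
  shows "(length P + length Q, height G s) \<in> trek_shapes G"
proof -
  have "(trek_length T, height G (trek_top T)) \<in> trek_shapes G"
    if "T \<in> treks G i j" "simple_trek T" for T
    using that unfolding trek_shapes_def by blast
  from this[OF assms] show ?thesis by simp
qed

lemma trek_shapesE:
  assumes "(l, a) \<in> trek_shapes G"
  obtains s P Q i j where "(s, P, Q) \<in> treks G i j" "simple_trek (s, P, Q)"
    "l = length P + length Q" "a = height G s"
proof -
  obtain T i j where T: "T \<in> treks G i j" "simple_trek T" "l = trek_length T" "a = height G (trek_top T)"
    using assms unfolding trek_shapes_def by blast
  obtain s P Q where "T = (s, P, Q)" by (rule prod_cases3)
  with T show ?thesis by (intro that[of s P Q i j]) simp_all
qed

section \<open>Walks, the root and unique parents\<close>

context directed_tree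
begin

sublocale tree_pair_digraph: pair_digraph G
proof
  show "finite (pverts G)" by (simp add: verts_eq)
  have "parcs G \<subseteq> pverts G \<times> pverts G" using wellformed' by auto
  then show "finite (parcs G)" by (rule finite_subset) (simp add: verts_eq)
  show "fst e \<noteq> snd e" if "e \<in> parcs G" for e
    using that dag unfolding acyclic_def by (metis prod.collapse r_into_trancl)
qed

lemma closed_awalk_empty:
  assumes "awalk u p u" shows "p = []"
proof (rule ccontr)
  assume "p \<noteq> []"
  then have "(u, u) \<in> (parcs G)\<^sup>+"
    using assms reachable1_awalk by blast
  then show False using dag by (auto simp: acyclic_def)
qed

text \<open>A repeated vertex would enclose a nonempty closed walk, which acyclicity excludes. Walks
  compose and split freely, so they replace paths from here on.\<close>

lemma dpath_iff_awalk: "dpath G u p v \<longleftrightarrow> awalk u p v"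
proof
  assume w: "awalk u p v"
  have "distinct (awalk_verts u p)"
  proof (rule ccontr)
    assume "\<not> distinct (awalk_verts u p)"
    then obtain q r s w where "0 < length r" "awalk w r w"
      using awalk_not_distinct_decomp[OF w] by blast
    then show False using closed_awalk_empty by fastforce
  qed
  with w show "apath u p v" by (simp add: apath_def)
qed (rule awalkI_apath)

lemma root_source: "source G (tree_root G)"
  unfolding tree_root_def using unique_source by (rule theI')

lemma source_eq_root: "source G v \<Longrightarrow> v = tree_root G"
  using root_source unique_source by blast

text \<open>Well-founded induction along the arcs: a vertex other than the only source has a
  predecessor, which is already reached.\<close>

lemma awalk_from_root:
  assumes "v \<in> pverts G" obtains p where "awalk (tree_root G) p v"
proof -
  have "wf (parcs G)"
    using dag tree_pair_digraph.pair_finite_arcs by (rule finite_acyclic_wf[rotated])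
  then have "v \<in> pverts G \<longrightarrow> (\<exists>p. awalk (tree_root G) p v)"
  proof (induction v rule: wf_induct_rule)
    case (less v)
    show ?case
    proof (cases "source G v")
      case True
      then show ?thesis
        using source_eq_root by (metis awalk_Nil_iff)
    next
      case False
      show ?thesis
      proof
        assume v: "v \<in> pverts G"
        with False obtain u where u: "(u, v) \<in> parcs G"
          by (auto simp: source_def in_arcs_def)
        with less obtain p where "awalk (tree_root G) p u" using wellformed' by blast
        moreover have "awalk u [(u, v)] v" using u v by (simp add: awalk_simps)
        ultimately show "\<exists>p. awalk (tree_root G) p v" by (blast intro: awalk_appendI)
      qed
    qed
  qed
  with assms that show ?thesis by blast
qed

text \<open>If the walks share a vertex \<open>x \<noteq> s\<close>, both are cut at
  \<open>x\<close> and only their tails are kept. The total length drops, so this ends at the vertex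
  where the walks branch for good.\<close>

lemma disjoint_awalks_from_branching:
  assumes "awalk s P i" "awalk s Q j"
  obtains s' P' Q' where "awalk s' P' i" "awalk s' Q' j"
    "set (pawalk_verts s' P') \<inter> set (pawalk_verts s' Q') = {s'}"
proof -
  have "\<exists>s' P' Q'. awalk s' P' i \<and> awalk s' Q' j \<and>
    set (pawalk_verts s' P') \<inter> set (pawalk_verts s' Q') = {s'}"
    using assms
  proof (induction "length P + length Q" arbitrary: s P Q rule: less_induct)
    case less
    show ?case
    proof (cases "set (pawalk_verts s P) \<inter> set (pawalk_verts s Q) = {s}")
      case True
      with less.prems show ?thesis by blast
    next
      case False
      moreover have "s \<in> set (pawalk_verts s P) \<inter> set (pawalk_verts s Q)"
        using less.prems hd_in_awalk_verts by blast
      ultimately obtain x where x: "x \<in> set (pawalk_verts s P)" "x \<in> set (pawalk_verts s Q)" "x \<noteq> s"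
        by blast
      obtain P1 P2 where P: "P = P1 @ P2" "awalk s P1 x" "awalk x P2 i"
        using awalk_decomp[OF less.prems(1) x(1)] by blast
      obtain Q1 Q2 where Q: "Q = Q1 @ Q2" "awalk s Q1 x" "awalk x Q2 j"
        using awalk_decomp[OF less.prems(2) x(2)] by blast
      have "P1 \<noteq> []" using P(2) x(3) awalk_empty_ends by blast
      then have "length P2 + length Q2 < length P + length Q"
        using P(1) Q(1) by simp
      from less.hyps[OF this P(3) Q(3)] show ?thesis .
    qed
  qed
  with that show ?thesis by blast
qed

text \<open>Acyclicity alone would allow two parents; the tree condition on the underlying graph
  enters here. Uniqueness of walks rests on this lemma.\<close>

lemma unique_parent:
  assumes arcs: "(u1, v) \<in> parcs G" "(u2, v) \<in> parcs G"
  shows "u1 = u2"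
proof (rule ccontr)
  assume neq: "u1 \<noteq> u2"
  define H where "H = mk_symmetric (with_proj G)"
  interpret H: pair_sym_digraph H
    unfolding H_def using wellformed_mk_symmetric symmetric_mk_symmetric[of "with_proj G"]
    by (simp add: pair_sym_digraph_def pair_sym_digraph_axioms_def)
  have sub: "parcs G \<subseteq> parcs H" "pverts G = pverts H"
    by (auto simp: H_def parcs_mk_symmetric)
  have H_awalk: "H.awalk a p b" if "awalk a p b" for a p b
    using that sub by (auto simp: awalk_def H.awalk_def)
  obtain P0 Q0 where "awalk (tree_root G) P0 u1" "awalk (tree_root G) Q0 u2"
    using awalk_from_root arcs wellformed' by metis
  then obtain s P Q where PQ: "awalk s P u1" "awalk s Q u2"
    "set (pawalk_verts s P) \<inter> set (pawalk_verts s Q) = {s}"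
    by (rule disjoint_awalks_from_branching)
  \<comment> \<open>A walk through \<open>v\<close> to one of its parents would be closed to a
    directed cycle by the arc into \<open>v\<close>.\<close>
  have off: "v \<notin> set (pawalk_verts s R)" if R: "awalk s R u" "(u, v) \<in> parcs G" for R u
  proof
    assume "v \<in> set (pawalk_verts s R)"
    then obtain R2 where "awalk v R2 u" using awalk_decomp[OF R(1)] by blast
    moreover have "awalk u [(u, v)] v" using R wellformed' by (simp add: awalk_simps)
    ultimately have "awalk v (R2 @ [(u, v)]) v" by (rule awalk_appendI)
    then show False using closed_awalk_empty by blast
  qed
  have dist: "distinct (pawalk_verts s P)" "distinct (pawalk_verts s Q)"
    using PQ dpath_iff_awalk by (auto simp: apath_def)
  \<comment> \<open>Two disjoint walks into \<open>v\<close> close up to a forbidden cycle of the underlying graph.\<close>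
  define C where "C = P @ (u1, v) # (v, u2) # rev_path Q"
  have "(u1, v) \<in> parcs H" "(v, u2) \<in> parcs H"
    using arcs sub H.arcs_symmetric by auto
  moreover have "H.awalk u2 (rev_path Q) s"
    using H_awalk PQ(2) by simp
  ultimately have tail: "H.awalk u1 ((u1, v) # (v, u2) # rev_path Q) s"
    using H.wellformed' by (simp add: H.awalk_simps)
  have walk: "H.awalk s C s"
    unfolding C_def using H.awalk_appendI[OF H_awalk[OF PQ(1)] tail] .
  have "pawalk_verts s C = pawalk_verts s P @ v # rev (pawalk_verts s Q)"
    using H.awalk_verts_append[OF walk[unfolded C_def]] H.awalk_verts_rev_path[OF H_awalk[OF PQ(2)]]
      H_awalk[OF PQ(1)]
    by (simp add: C_def)
  moreover obtain VP where VP: "pawalk_verts s P = s # VP"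
    using PQ(1) by (cases P) (auto simp: awalk_Cons_iff)
  \<comment> \<open>Dropping the head removes one of the two occurrences of \<open>s\<close>; the
    other ends the reversed vertices of \<open>Q\<close>.\<close>
  ultimately have "tl (pawalk_verts s C) = VP @ v # rev (pawalk_verts s Q)" by simp
  moreover have "distinct (VP @ v # rev (pawalk_verts s Q))"
  proof -
    have "s \<notin> set VP" "distinct VP" "v \<notin> set VP"
      using dist(1) off[OF PQ(1) arcs(1)] unfolding VP by simp_all
    moreover from this(1) have "set VP \<inter> set (pawalk_verts s Q) = {}"
      using PQ(3) unfolding VP by auto
    ultimately show ?thesis using dist(2) off[OF PQ(2) arcs(2)] by simp
  qed
  ultimately have "H.cycle C"
    using walk by (auto simp: H.cycle_def C_def)
  \<comment> \<open>As \<open>u1 \<noteq> u2\<close>, one of \<open>P\<close> and \<open>Q\<close>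
    is nonempty and adds to the two arcs at \<open>v\<close>.\<close>
  moreover have "3 \<le> length C"
  proof -
    have "P \<noteq> [] \<or> Q \<noteq> []" using PQ(1,2) neq by (auto simp: awalk_Nil_iff)
    moreover have "length (rev_path Q) = length Q" by (induct Q) auto
    ultimately show ?thesis unfolding C_def by (cases P; cases Q) auto
  qed
  ultimately show False
    using underlying unfolding underlying_tree_def H_def by blast
qed

section \<open>Uniqueness of walks, and heights\<close>

text \<open>Read backwards from \<open>v\<close>, both walks are forced step by step by unique
  parents, until the shorter one is used up.\<close>

lemma awalk_suffix:
  assumes "awalk u p v" "awalk u' q v" "length p \<le> length q"
  shows "\<exists>x. q = x @ p \<and> awalk u' x u"
  using assms
proof (induction p arbitrary: v q rule: rev_induct)
  case Nil
  then show ?case by (auto simp: awalk_Nil_iff)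
next
  case (snoc e p)
  then obtain q' e' where q: "q = q' @ [e']" by (cases q rule: rev_cases) auto
  have p: "awalk u p (fst e)" "e \<in> parcs G" "snd e = v"
    using snoc.prems(1) by (auto simp: awalk_simps)
  have q': "awalk u' q' (fst e')" "e' \<in> parcs G" "snd e' = v"
    using snoc.prems(2) q by (auto simp: awalk_simps)
  have "e = e'" using p q' unique_parent by (metis prod.collapse)
  then show ?case using snoc.IH[OF p(1)] q'(1) q snoc.prems(3) by auto
qed

lemma awalk_unique:
  assumes "awalk u p v" "awalk u q v" shows "p = q"
proof -
  have "q = p" if "awalk u p v" "awalk u q v" "length p \<le> length q" for p q
    using awalk_suffix[OF that] closed_awalk_empty by auto
  with assms show ?thesis by (metis nat_le_linear)
qed

lemma height_eq_length:
  assumes "awalk (tree_root G) p v" shows "height G v = length p"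
proof -
  have "(THE p. dpath G (tree_root G) p v) = p"
    using assms awalk_unique by (auto simp: dpath_iff_awalk)
  then show ?thesis by (simp add: height_def)
qed

text \<open>The walk is prefixed by the one from the root. Lengths of walks can thus be compared
  through the heights of their ends.\<close>

lemma height_awalk:
  assumes "awalk u p v" shows "height G v = height G u + length p"
proof -
  obtain q where q: "awalk (tree_root G) q u" using assms awalk_from_root by blast
  then have "awalk (tree_root G) (q @ p) v" using assms by (rule awalk_appendI)
  from height_eq_length[OF this] height_eq_length[OF q] show ?thesis by simp
qed

text \<open>The last \<open>c\<close> arcs of the walk from the root serve. This is what moves the
  top of a trek up by \<open>c\<close> steps.\<close>

lemma awalk_into_of_length:
  assumes "v \<in> pverts G" "c \<le> height G v"
  obtains u p where "awalk u p v" "length p = c"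
proof -
  obtain q where q: "awalk (tree_root G) q v" using assms awalk_from_root by blast
  define d where "d = length q - c"
  have "awalk (tree_root G) (take d q @ drop d q) v" using q by simp
  then have "awalk (last (pawalk_verts (tree_root G) (take d q))) (drop d q) v"
    unfolding awalk_append_iff by blast
  moreover have "length (drop d q) = c" using assms height_eq_length[OF q] by (simp add: d_def)
  ultimately show ?thesis using that by blast
qed

section \<open>Treks between two vertices and their vectors\<close>

lemma treks_iff: "(s, P, Q) \<in> treks G i j \<longleftrightarrow> awalk s P i \<and> awalk s Q j"
  by (simp add: treks_def dpath_iff_awalk)

lemma simple_trek_between:
  assumes "i \<in> pverts G" "j \<in> pverts G"
  obtains T where "T \<in> treks G i j" "simple_trek T"
proof -
  obtain P Q where "awalk (tree_root G) P i" "awalk (tree_root G) Q j"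
    using awalk_from_root assms by metis
  then obtain s P' Q' where "awalk s P' i" "awalk s Q' j"
    "set (pawalk_verts s P') \<inter> set (pawalk_verts s Q') = {s}"
    by (rule disjoint_awalks_from_branching)
  then have "(s, P', Q') \<in> treks G i j" "simple_trek (s, P', Q')" by (simp_all add: treks_iff)
  then show ?thesis by (rule that)
qed

lemma length_awalk_less: "awalk u p v \<Longrightarrow> length p < card (pverts G)"
  using tree_pair_digraph.length_apath_less dpath_iff_awalk by blast

lemma finite_trek_lengths: "finite {trek_length T |T i j. T \<in> treks G i j}"
proof (rule finite_subset)
  show "{trek_length T |T i j. T \<in> treks G i j} \<subseteq> {..2 * card (pverts G)}"
  proof clarify
    fix s P Q i j
    assume "(s, P, Q) \<in> treks G i j"
    then have "length P < card (pverts G)" "length Q < card (pverts G)"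
      using length_awalk_less unfolding treks_iff by blast+
    then show "trek_length (s, P, Q) \<le> 2 * card (pverts G)" by simp
  qed
qed simp

lemma trek_length_le_longest: "T \<in> treks G i j \<Longrightarrow> trek_length T \<le> longest_trek G"
  unfolding longest_trek_def using finite_trek_lengths by (intro Max_ge) blast+

text \<open>Walks with a common end are suffixes of each other, so the two tops are comparable. A
  top above \<open>s\<close> extends both paths by the same walk; simplicity excludes one below
  \<open>s\<close>.\<close>

lemma trek_through_simple_trek:
  assumes simple: "(s, P, Q) \<in> treks G i j" "simple_trek (s, P, Q)"
    and trek: "(s', P', Q') \<in> treks G i j"
  obtains X where "P' = X @ P" "Q' = X @ Q" "awalk s' X s"
proof -
  have w: "awalk s P i" "awalk s Q j" "awalk s' P' i" "awalk s' Q' j"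
    using simple(1) trek by (auto simp: treks_iff)
  \<comment> \<open>The heights of the ends give equal differences in length between
    \<open>P'\<close> and \<open>P\<close> and between \<open>Q'\<close> and \<open>Q\<close>, so
    one case split settles both paths.\<close>
  note h = w[THEN height_awalk]
  show ?thesis
  proof (cases "length P \<le> length P'")
    case True
    then have "length Q \<le> length Q'" using h by linarith
    with True w obtain X Y where "P' = X @ P" "awalk s' X s" "Q' = Y @ Q" "awalk s' Y s"
      using awalk_suffix by meson
    with that awalk_unique show ?thesis by blast
  next
    case False
    then have "length P' \<le> length P" "length Q' \<le> length Q" using h by linarith+
    with w obtain X Y where X: "P = X @ P'" "awalk s X s'" and Y: "Q = Y @ Q'" "awalk s Y s'"
      using awalk_suffix by meson
    have "s' \<in> set (pawalk_verts s P)" "s' \<in> set (pawalk_verts s Q)"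
      using set_awalk_verts_append[of s X s' P'] set_awalk_verts_append[of s Y s' Q']
        X Y w hd_in_awalk_verts by auto
    \<comment> \<open>The top \<open>s\<close> is the only vertex shared by \<open>P\<close> and
      \<open>Q\<close>.\<close>
    then have "s' = s" using simple(2) by auto
    then have "X = []" using X(2) closed_awalk_empty by blast
    with X(1) False show ?thesis by simp
  qed
qed

text \<open>Every trek extends the simple one by a walk \<open>X\<close> into \<open>s\<close>,
  which adds \<open>2 * length X\<close> to the length. Such a walk exists exactly for lengths up to
  the height of \<open>s\<close> and is determined by its length, so all entries are 0 or 1.\<close>

lemma trek_vector_simple_trek:
  assumes simple: "(s, P, Q) \<in> treks G i j" "simple_trek (s, P, Q)"
  shows "trek_vector G i j = progression_vector G (length P + length Q) (height G s)"
  unfolding trek_vector_def progression_vector_def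
proof (rule restrict_ext)
  fix k
  define l where "l = length P + length Q"
  define a where "a = height G s"
  have w: "awalk s P i" "awalk s Q j" using simple(1) by (auto simp: treks_iff)
  have ext: "\<exists>X. P' = X @ P \<and> Q' = X @ Q \<and> awalk s' X s \<and> length X \<le> a"
    if "(s', P', Q') \<in> treks G i j" for s' P' Q'
    using trek_through_simple_trek[OF simple that] height_awalk unfolding a_def by (metis le_add2)
  have "card {T \<in> treks G i j. trek_length T = k} = of_bool (l \<le> k \<and> k \<le> l + 2 * a \<and> even (k + l))"
  proof (cases "l \<le> k \<and> k \<le> l + 2 * a \<and> even (k + l)")
    case True
    \<comment> \<open>The number of steps by which the top moves up; each step lengthens both paths
      by one arc.\<close>
    define c where "c = (k - l) div 2"
    have c: "c \<le> a" "k = l + 2 * c" using True unfolding c_def by presburger+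
    obtain t X where X: "awalk t X s" "length X = c"
      using awalk_into_of_length[of s c] w c(1) unfolding a_def by blast
    have "T = (t, X @ P, X @ Q)" if T: "T \<in> treks G i j" "trek_length T = k" for T
    proof -
      obtain s' P' Q' where T': "T = (s', P', Q')" using prod_cases3 by blast
      then obtain Y where Y: "P' = Y @ P" "Q' = Y @ Q" "awalk s' Y s" using ext T(1) by blast
      have "length Y = length X" using T(2) T' Y X c(2) by (simp add: l_def)
      with awalk_suffix[OF X(1) Y(3)] obtain Z where "Y = Z @ X" "awalk s' Z t" by auto
      with \<open>length Y = length X\<close> have "Y = X" "s' = t" by (auto simp: awalk_Nil_iff)
      with T' Y show ?thesis by simp
    qed
    moreover have "(t, X @ P, X @ Q) \<in> treks G i j" "trek_length (t, X @ P, X @ Q) = k"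
      using X w c awalk_appendI by (auto simp: treks_iff l_def simp del: awalk_append_iff)
    ultimately have "{T \<in> treks G i j. trek_length T = k} = {(t, X @ P, X @ Q)}" by blast
    with True show ?thesis by simp
  next
    case False
    have "trek_length T \<noteq> k" if "T \<in> treks G i j" for T
    proof -
      obtain s' P' Q' where T': "T = (s', P', Q')" using prod_cases3 by blast
      with ext that obtain X where "P' = X @ P" "Q' = X @ Q" "length X \<le> a" by blast
      with T' have "trek_length T = l + 2 * length X" "length X \<le> a" by (auto simp: l_def)
      with False show ?thesis by auto
    qed
    then have "{T \<in> treks G i j. trek_length T = k} = {}" by blast
    with False show ?thesis by (simp only: card.empty of_bool_def if_False)
  qed
  then show "card {T \<in> treks G i j. trek_length T = k} =
    of_bool (length P + length Q \<le> k \<and> k \<le> length P + length Q + 2 * height G s \<and>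
      even (k + (length P + length Q)))"
    by (simp add: l_def a_def)
qed

text \<open>Swapping the two paths is a length-preserving bijection. It is needed because
  \<open>vertex_pairs\<close> contains only pairs with \<open>i \<le> j\<close>, while a shape may
  come from a trek in either order.\<close>

lemma trek_vector_commute: "trek_vector G i j = trek_vector G j i"
proof -
  have "card {T \<in> treks G i j. trek_length T = k} = card {T \<in> treks G j i. trek_length T = k}" for k
    by (rule bij_betw_same_card[of "\<lambda>(s, P, Q). (s, Q, P)"],
        rule bij_betw_byWitness[where f' = "\<lambda>(s, P, Q). (s, Q, P)"])
      (auto simp: treks_iff)
  then show ?thesis unfolding trek_vector_def by (intro restrict_ext)
qed

lemma trek_vectors_eq:
  "{trek_vector G i j |i j. (i, j) \<in> vertex_pairs G} =
    {progression_vector G l a |l a. (l, a) \<in> trek_shapes G}"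
proof (intro equalityI subsetI)
  fix f assume "f \<in> {trek_vector G i j |i j. (i, j) \<in> vertex_pairs G}"
  then obtain i j where f: "f = trek_vector G i j" "i \<in> pverts G" "j \<in> pverts G"
    by (auto simp: vertex_pairs_def)
  then obtain T where T: "T \<in> treks G i j" "simple_trek T" using simple_trek_between by blast
  obtain s P Q where T': "T = (s, P, Q)" by (rule prod_cases3)
  have "f = progression_vector G (length P + length Q) (height G s)"
    unfolding f(1) by (rule trek_vector_simple_trek[OF T[unfolded T']])
  then show "f \<in> {progression_vector G l a |l a. (l, a) \<in> trek_shapes G}"
    using trek_shapesI[OF T[unfolded T']] by blast
next
  fix f assume "f \<in> {progression_vector G l a |l a. (l, a) \<in> trek_shapes G}"
  then obtain l a where la: "(l, a) \<in> trek_shapes G" "f = progression_vector G l a" by blast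
  from la(1) obtain s P Q i j where T: "(s, P, Q) \<in> treks G i j" "simple_trek (s, P, Q)"
    and f: "l = length P + length Q" "a = height G s" by (rule trek_shapesE)
  have "i \<in> pverts G" "j \<in> pverts G" using T(1) by (auto simp: treks_iff)
  then have "(i, j) \<in> vertex_pairs G \<or> (j, i) \<in> vertex_pairs G" by (auto simp: vertex_pairs_def)
  moreover have ij: "f = trek_vector G i j"
    unfolding la(2) f by (rule trek_vector_simple_trek[OF T, symmetric])
  moreover have "f = trek_vector G j i"
    unfolding ij by (rule trek_vector_commute)
  ultimately show "f \<in> {trek_vector G i j |i j. (i, j) \<in> vertex_pairs G}"
    by blast
qed

section \<open>The shapes described by height and width\<close>

text \<open>Moving the top up to the root gives a trek of length \<open>l + 2 * a\<close>. The whole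
  progression therefore lies in the index range and is not cut off.\<close>

lemma trek_shape_length_le:
  assumes "(l, a) \<in> trek_shapes G" shows "l + 2 * a \<le> longest_trek G"
proof -
  obtain s P Q i j where T: "(s, P, Q) \<in> treks G i j" "l = length P + length Q" "a = height G s"
    using assms by (rule trek_shapesE)
  then obtain X where X: "awalk (tree_root G) X s" using awalk_from_root by (auto simp: treks_iff)
  then have "(tree_root G, X @ P, X @ Q) \<in> treks G i j"
    using T awalk_appendI by (auto simp: treks_iff simp del: awalk_append_iff)
  from trek_length_le_longest[OF this] show ?thesis
    using T height_eq_length[OF X] by simp
qed

text \<open>Removing the last arc of a nonempty path keeps the top and only shrinks the vertex set
  of that path, so the trek stays simple.\<close>

lemma trek_shape_shorten:
  assumes "(Suc l, a) \<in> trek_shapes G" shows "(l, a) \<in> trek_shapes G"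
proof -
  obtain s P Q i j where T: "(s, P, Q) \<in> treks G i j" "simple_trek (s, P, Q)"
    "Suc l = length P + length Q" "a = height G s"
    using assms by (rule trek_shapesE)
  have shorten: "\<exists>i'. awalk s R' i' \<and> set (pawalk_verts s R') \<subseteq> set (pawalk_verts s R) \<and>
      s \<in> set (pawalk_verts s R')"
    if R: "awalk s R u" "R = R' @ [e]" for R R' e u
  proof -
    have "awalk s R' (fst e)" "awalk (fst e) [e] u" using R by (auto simp: awalk_simps)
    then show ?thesis using set_awalk_verts_append R hd_in_awalk_verts by blast
  qed
  have "P \<noteq> [] \<or> Q \<noteq> []" using T(3) by auto
  then obtain P' Q' i' j' where "(s, P', Q') \<in> treks G i' j'" "simple_trek (s, P', Q')"
    "l = length P' + length Q'"
  proof
    assume "P \<noteq> []"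
    then obtain P' e where P: "P = P' @ [e]" using rev_exhaust by blast
    then obtain i' where "awalk s P' i'" "set (pawalk_verts s P') \<subseteq> set (pawalk_verts s P)"
      "s \<in> set (pawalk_verts s P')"
      using shorten T(1) unfolding treks_iff by metis
    with P T show ?thesis by (intro that[of P' Q i' j]) (auto simp: treks_iff)
  next
    assume "Q \<noteq> []"
    then obtain Q' e where Q: "Q = Q' @ [e]" using rev_exhaust by blast
    then obtain j' where "awalk s Q' j'" "set (pawalk_verts s Q') \<subseteq> set (pawalk_verts s Q)"
      "s \<in> set (pawalk_verts s Q')"
      using shorten T(1) unfolding treks_iff by metis
    with Q T show ?thesis by (intro that[of P Q' i j']) (auto simp: treks_iff)
  qed
  with T(4) trek_shapesI show ?thesis by blast
qed

lemma trek_shape_antimono: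
  assumes "(l, a) \<in> trek_shapes G" "l' \<le> l" shows "(l', a) \<in> trek_shapes G"
  using assms(2,1) by (induction rule: inc_induct) (auto intro: trek_shape_shorten)

lemma finite_dpath_lengths: "finite {length p |u p v. dpath G u p v}"
  by (rule finite_subset[of _ "{..card (pverts G)}"])
    (auto simp: dpath_iff_awalk dest: length_awalk_less)

lemma height_le_graph_height:
  assumes "v \<in> pverts G" shows "height G v \<le> graph_height G"
proof -
  obtain p where "awalk (tree_root G) p v" using assms awalk_from_root by blast
  then show ?thesis
    unfolding graph_height_def using finite_dpath_lengths
    by (intro Max_ge) (auto simp: height_eq_length dpath_iff_awalk)
qed

text \<open>The end of a longest path has at least the height of the tree, and the way up from it to
  the root passes every smaller height.\<close>

lemma vertex_of_height:
  assumes "a \<le> graph_height G" obtains v where "v \<in> pverts G" "height G v = a"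
proof -
  have "dpath G (tree_root G) [] (tree_root G)"
    using root_source by (simp add: dpath_iff_awalk awalk_Nil_iff source_def)
  then have "graph_height G \<in> {length p |u p v. dpath G u p v}"
    unfolding graph_height_def using finite_dpath_lengths by (intro Max_in) blast+
  then obtain u p v where p: "awalk u p v" "graph_height G = length p"
    by (auto simp: dpath_iff_awalk)
  then have h: "a \<le> height G v" using height_awalk assms by auto
  have "v \<in> pverts G" using p by blast
  with h obtain t q where q: "awalk t q v" "length q = height G v - a"
    using awalk_into_of_length by (metis diff_le_self)
  then have "height G t = a" using height_awalk h by fastforce
  with q that show ?thesis by blast
qed

text \<open>Treks with two empty paths realise every height that occurs; hence the maximum in
  \<open>width\<close> is taken over a nonempty set.\<close>

lemma trek_shape_0_iff: "(0, a) \<in> trek_shapes G \<longleftrightarrow> a \<le> graph_height G"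
proof
  assume "(0, a) \<in> trek_shapes G"
  then obtain s P Q i j where "(s, P, Q) \<in> treks G i j" "a = height G s"
    by (rule trek_shapesE)
  then show "a \<le> graph_height G" using height_le_graph_height by (auto simp: treks_iff)
next
  assume "a \<le> graph_height G"
  then obtain v where "v \<in> pverts G" "height G v = a" by (rule vertex_of_height)
  then have "(v, [], []) \<in> treks G v v" "simple_trek (v, [], [])" "height G v = a"
    by (simp_all add: treks_iff awalk_Nil_iff)
  then show "(0, a) \<in> trek_shapes G" using trek_shapesI by fastforce
qed

text \<open>For a fixed top height the lengths form a finite set closed downwards, so the maximum
  describes it completely.\<close>

lemma trek_shape_iff:
  "(l, a) \<in> trek_shapes G \<longleftrightarrow> a \<le> graph_height G \<and> l \<le> width G a"
proof -
  have w: "width G a = Max {l. (l, a) \<in> trek_shapes G}"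
    unfolding width_def trek_shapes_def by (rule arg_cong[where f = Max]) blast
  have fin: "finite {l. (l, a) \<in> trek_shapes G}"
    by (rule finite_subset[of _ "{..longest_trek G}"]) (auto dest: trek_shape_length_le)
  show ?thesis
  proof
    assume "(l, a) \<in> trek_shapes G"
    then show "a \<le> graph_height G \<and> l \<le> width G a"
      using w fin trek_shape_antimono[of l a 0] trek_shape_0_iff by auto
  next
    assume l: "a \<le> graph_height G \<and> l \<le> width G a"
    then have "{l. (l, a) \<in> trek_shapes G} \<noteq> {}" using trek_shape_0_iff by blast
    from Max_in[OF fin this] have "(width G a, a) \<in> trek_shapes G" using w by simp
    with l show "(l, a) \<in> trek_shapes G" using trek_shape_antimono by blast
  qed
qed

text \<open>A single arc leaving a vertex of height \<open>a\<close> is a simple trek.\<close>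

lemma width_positive:
  assumes "a < graph_height G" shows "0 < width G a"
proof -
  obtain v where v: "v \<in> pverts G" "height G v = Suc a"
    using vertex_of_height assms by (metis Suc_leI)
  then obtain u p where p: "awalk u p v" "length p = Suc 0"
    using awalk_into_of_length by (metis Suc_le_mono zero_le)
  then have "height G u = a" using height_awalk v by fastforce
  moreover have "(u, [], p) \<in> treks G u v" "simple_trek (u, [], p)"
    using p hd_in_awalk_verts by (auto simp: treks_iff awalk_Nil_iff)
  ultimately have "(Suc 0, a) \<in> trek_shapes G" using trek_shapesI p(2) by fastforce
  then show ?thesis by (simp add: trek_shape_iff)
qed

section \<open>Antimonotone width gives a pi-graph\<close>

text \<open>Minima of indicators are indicators of intersections, and two progressions of step 2
  meet in such a progression or not at all.\<close>

lemma min_progression_vectors: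
  assumes anti: "\<And>h h'. h \<le> h' \<Longrightarrow> h' \<le> graph_height G \<Longrightarrow> width G h' \<le> width G h"
    and shapes: "(l, a) \<in> trek_shapes G" "(l', a') \<in> trek_shapes G"
  shows "(\<lambda>k\<in>{0..longest_trek G}. min (progression_vector G l a k) (progression_vector G l' a' k))
    \<in> insert (\<lambda>k\<in>{0..longest_trek G}. 0) {progression_vector G l a |l a. (l, a) \<in> trek_shapes G}"
    (is "?M l a l' a' \<in> ?R")
proof -
  have "?M l a l' a' \<in> ?R"
    if shapes: "(l, a) \<in> trek_shapes G" "(l', a') \<in> trek_shapes G" and "l \<le> l'" for l a l' a'
  proof (cases "even (l + l') \<and> l' \<le> l + 2 * a")
    case True
    define c where "c = (l' - l) div 2"
    have "even (l' - l)" using True \<open>l \<le> l'\<close> by simp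
    then have c: "l' = l + 2 * c" "c \<le> a" using True \<open>l \<le> l'\<close> by (auto simp: c_def)
    \<comment> \<open>The progressions end at \<open>l' + 2 * a'\<close> and at
      \<open>l + 2 * a = l' + 2 * (a - c)\<close>; the earlier end counts.\<close>
    define b where "b = min a' (a - c)"
    have "b \<le> a'" by (simp add: b_def)
    \<comment> \<open>Antimonotonicity enters here:
      \<open>l' \<le> width G a' \<le> width G b\<close>.\<close>
    then have "(l', b) \<in> trek_shapes G"
      using shapes(2) anti[of b a'] by (auto simp: trek_shape_iff)
    moreover have "?M l a l' a' = progression_vector G l' b"
      unfolding progression_vector_def[of G l' b]
    proof (rule restrict_ext)
      fix k assume k: "k \<in> {0..longest_trek G}"
      have "(l \<le> k \<and> k \<le> l + 2 * a \<and> even (k + l)) \<and> (l' \<le> k \<and> k \<le> l' + 2 * a' \<and> even (k + l'))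
        \<longleftrightarrow> l' \<le> k \<and> k \<le> l' + 2 * b \<and> even (k + l')"
        using c(2) unfolding c(1) b_def by auto
      then show "min (progression_vector G l a k) (progression_vector G l' a' k)
        = of_bool (l' \<le> k \<and> k \<le> l' + 2 * b \<and> even (k + l'))"
        unfolding progression_vector_apply[OF k] min_of_bool by (rule arg_cong)
    qed
    ultimately show ?thesis by blast
  next
    case False
    \<comment> \<open>Either the parities differ or the first progression ends before the second
      starts.\<close>
    have "?M l a l' a' = (\<lambda>k\<in>{0..longest_trek G}. 0)"
    proof (rule restrict_ext)
      fix k assume k: "k \<in> {0..longest_trek G}"
      have "\<not> ((l \<le> k \<and> k \<le> l + 2 * a \<and> even (k + l)) \<and> (l' \<le> k \<and> k \<le> l' + 2 * a' \<and> even (k + l')))"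
        using False by (metis even_add le_trans)
      then show "min (progression_vector G l a k) (progression_vector G l' a' k) = 0"
        unfolding progression_vector_apply[OF k] min_of_bool by (simp only: of_bool_eq_0_iff not_False_eq_True)
    qed
    then show ?thesis by (rule insertCI)
  qed
  note wlog = this
  show ?thesis
  proof (cases "l \<le> l'")
    case True
    with wlog shapes show ?thesis by blast
  next
    case False
    then have "?M l' a' l a \<in> ?R" using wlog[OF shapes(2,1)] by linarith
    then show ?thesis by (simp only: min.commute)
  qed
qed

lemma finite_vertex_pairs: "finite (vertex_pairs G)"
  by (rule finite_subset[of _ "pverts G \<times> pverts G"]) (auto simp: vertex_pairs_def verts_eq)

text \<open>The vectors of shapes together with zero are closed under binary minima, so induction
  over the finite set \<open>S\<close> reaches all meets.\<close>

lemma pi_graph_const_if_antimono: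
  assumes anti: "\<And>h h'. h \<le> h' \<Longrightarrow> h' \<le> graph_height G \<Longrightarrow> width G h' \<le> width G h"
  shows "pi_graph_const G"
proof -
  let ?N = "longest_trek G"
  let ?Z = "\<lambda>k\<in>{0..?N}. 0 :: nat"
  let ?V = "{progression_vector G l a |l a. (l, a) \<in> trek_shapes G}"
  let ?meet = "\<lambda>S. \<lambda>k\<in>{0..?N}. Min ((\<lambda>(i, j). trek_vector G i j k) ` S)"
  have V: "trek_vector G i j \<in> ?V" if "(i, j) \<in> vertex_pairs G" for i j
    using that trek_vectors_eq by blast
  have restrict: "(\<lambda>k\<in>{0..?N}. f k) = f" if "f \<in> ?V" for f
    using that by (auto simp: progression_vector_def)
  have "?meet S \<in> insert ?Z ?V" if "S \<noteq> {}" "S \<subseteq> vertex_pairs G" for S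
    using finite_subset[OF that(2) finite_vertex_pairs] that
  proof (induction S rule: finite_ne_induct)
    case (singleton x)
    obtain i j where x: "x = (i, j)" by (rule prod.exhaust)
    then have "trek_vector G i j \<in> ?V" using V singleton by blast
    with restrict[OF this] show ?case unfolding x by simp
  next
    case (insert x S)
    obtain i j where x: "x = (i, j)" by (rule prod.exhaust)
    then obtain l a where la: "(l, a) \<in> trek_shapes G" "trek_vector G i j = progression_vector G l a"
      using V[of i j] insert.prems by blast
    have step: "?meet (insert x S) = (\<lambda>k\<in>{0..?N}. min (progression_vector G l a k) (?meet S k))"
      using insert.hyps by (intro restrict_ext) (simp add: x la(2))
    have "?meet S = ?Z \<or> ?meet S \<in> ?V" using insert.IH insert.prems by blast
    then show ?case
    proof
      assume Z: "?meet S = ?Z"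
      have "?meet (insert x S) = ?Z" unfolding step Z by (intro restrict_ext) simp
      then show ?case by (rule insertCI)
    next
      assume "?meet S \<in> ?V"
      then obtain l' a' where "(l', a') \<in> trek_shapes G" "?meet S = progression_vector G l' a'" by blast
      then show ?case unfolding step by (simp only: min_progression_vectors[OF anti la(1)])
    qed
  qed
  then show ?thesis
    unfolding pi_graph_const_def trek_meets_def trek_vectors_eq by blast
qed

section \<open>A pi-graph has antimonotone width\<close>

text \<open>Both progressions lie in the index range, so comparing the vectors at the four end
  points recovers start and height.\<close>

lemma progression_vector_eq_shape:
  assumes shape: "(l, a) \<in> trek_shapes G" and h: "l' + 2 * a' \<le> longest_trek G"
    and eq: "progression_vector G l a = progression_vector G l' a'"
  shows "l = l' \<and> a = a'"
proof -
  have mem: "l \<le> k \<and> k \<le> l + 2 * a \<and> even (k + l) \<longleftrightarrow> l' \<le> k \<and> k \<le> l' + 2 * a' \<and> even (k + l')"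
    if "k \<le> longest_trek G" for k
    using fun_cong[OF eq, of k] that by (auto simp: progression_vector_def of_bool_eq_iff)
  note ends = mem[of l] mem[of "l + 2 * a"] mem[of l'] mem[of "l' + 2 * a'"]
  then show ?thesis using trek_shape_length_le[OF shape] h by auto
qed

lemma width_Suc_le_if_pi_graph_const:
  assumes pi: "pi_graph_const G" and h: "Suc h \<le> graph_height G"
  shows "width G (Suc h) \<le> width G h"
proof (rule ccontr)
  assume "\<not> width G (Suc h) \<le> width G h"
  then have less: "width G h < width G (Suc h)" by simp
  \<comment> \<open>No truncation occurs: \<open>0 < width G h < width G (Suc h)\<close>.\<close>
  define l where "l = width G (Suc h) - 2"
  have l: "width G (Suc h) = l + 2" using less width_positive[of h] h by (simp add: l_def)
  have shapes: "(l, Suc h) \<in> trek_shapes G" "(l + 2, Suc h) \<in> trek_shapes G"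
    using h l by (simp_all add: trek_shape_iff)
  then have "{progression_vector G l (Suc h), progression_vector G (l + 2) (Suc h)}
    \<subseteq> {trek_vector G i j |i j. (i, j) \<in> vertex_pairs G}"
    unfolding trek_vectors_eq by blast
  then obtain i j i' j' where ij: "(i, j) \<in> vertex_pairs G" "(i', j') \<in> vertex_pairs G"
    "trek_vector G i j = progression_vector G l (Suc h)"
    "trek_vector G i' j' = progression_vector G (l + 2) (Suc h)"
    unfolding insert_subset by (elim conjE CollectE exE) metis
  let ?M = "\<lambda>k\<in>{0..longest_trek G}. Min ((\<lambda>(i, j). trek_vector G i j k) ` {(i, j), (i', j')})"
  \<comment> \<open>The meet starts with the second progression and ends with the first, at
    \<open>l + 2 * Suc h = (l + 2) + 2 * h\<close>.\<close>
  have M: "?M = progression_vector G (l + 2) h"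
    unfolding progression_vector_def[of G "l + 2" h]
  proof (rule restrict_ext)
    fix k assume k: "k \<in> {0..longest_trek G}"
    have "Min ((\<lambda>(i, j). trek_vector G i j k) ` {(i, j), (i', j')})
      = min (progression_vector G l (Suc h) k) (progression_vector G (l + 2) (Suc h) k)"
      by (simp add: ij(3,4))
    also have "\<dots> = of_bool (l + 2 \<le> k \<and> k \<le> l + 2 + 2 * h \<and> even (k + (l + 2)))"
      unfolding progression_vector_apply[OF k] min_of_bool by (rule arg_cong[where f = of_bool]) auto
    finally show "Min ((\<lambda>(i, j). trek_vector G i j k) ` {(i, j), (i', j')}) =
      of_bool (l + 2 \<le> k \<and> k \<le> l + 2 + 2 * h \<and> even (k + (l + 2)))" .
  qed
  have "?M \<in> trek_meets G" unfolding trek_meets_def using ij(1,2) by blast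
  then have "progression_vector G (l + 2) h \<in>
    {\<lambda>k\<in>{0..longest_trek G}. 0} \<union> {progression_vector G l a |l a. (l, a) \<in> trek_shapes G}"
    using pi unfolding pi_graph_const_def trek_vectors_eq M by blast
  \<comment> \<open>The entry at \<open>l + 2\<close> is 1, and this index is in range since a shape
    has that length.\<close>
  moreover have "progression_vector G (l + 2) h \<noteq> (\<lambda>k\<in>{0..longest_trek G}. 0)"
  proof
    assume "progression_vector G (l + 2) h = (\<lambda>k\<in>{0..longest_trek G}. 0)"
    from fun_cong[OF this, of "l + 2"] trek_shape_length_le[OF shapes(2)] show False
      by (simp add: progression_vector_def)
  qed
  ultimately obtain l' a where "(l', a) \<in> trek_shapes G"
    "progression_vector G (l + 2) h = progression_vector G l' a" by blast
  then have "(l + 2, h) \<in> trek_shapes G"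
    using progression_vector_eq_shape[of l' a "l + 2" h] trek_shape_length_le[OF shapes(2)] by fastforce
  with less l show False by (simp add: trek_shape_iff)
qed

end

theorem theorem4p19:
  fixes m :: nat and G :: "nat pair_pre_digraph"
  assumes "directed_tree m G"
  shows "pi_graph_const G \<longleftrightarrow>
    (\<forall>h h'. 0 \<le> h \<and> h \<le> h' \<and> h' \<le> graph_height G \<longrightarrow> width G h \<ge> width G h')"
proof -
  interpret directed_tree m G by fact
  show ?thesis
  proof
    assume pi: "pi_graph_const G"
    have "width G h' \<le> width G h" if "h \<le> h'" "h' \<le> graph_height G" for h h'
      using that
    proof (induction rule: dec_induct)
      case (step n)
      then show ?case using width_Suc_le_if_pi_graph_const[OF pi, of n] by simp
    qed simp
    then show "\<forall>h h'. 0 \<le> h \<and> h \<le> h' \<and> h' \<le> graph_height G \<longrightarrow> width G h \<ge> width G h'" by blast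
  qed (blast intro: pi_graph_const_if_antimono)
qed

end
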